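(* If $G$ is a graph cellularly embedded in the sphere or in the real projective plane, then $L_G(t+1,t+1,1)=R_G(t+1,t,1/t)$. If $G$ is a graph cellularly embedded in the torus, then \[ L_{2,G}(t+1,t+1)+t\,L_{1,G}(t+1,t+1)+L_{0,G}(t+1,t+1)=R_G(t+1,t,1/t), \] where, viewing $L_G(x,y,z)$ as a polynomial in $z$ with coefficients in $\mathbb{Z}[x,y]$, $L_{i,G}(x,y)$ denotes the coefficient of $z^i$.
   Context: For a graph $H$ and $A\subseteq E(H)$, $r_H(A)=v(H)-c_H(A)$ where $c_H(A)$ is the number of components of the spanning subgraph $(V(H),A)$, and $n_H(A)=|A|-r_H(A)$. For a cellularly embedded graph (ribbon graph) $G$ and $A\subseteq E(G)$, $f_G(A)$ is the number of boundary components of the spanning ribbon subgraph $(V(G),A)$. The Bollob\'as--Riordan polynomial is $R_G(x,y,z)=\sum_{A\subseteq E(G)}(x-1)^{r_G(E(G))-r_G(A)}y^{n_G(A)}z^{c_G(A)-f_G(A)+n_G(A)}$. The Las Vergnas polynomial is $L_G(x,y,z)=T_{B(G^* )\to C(G)}(x,y,z)=\sum_{X\subseteq E}(x-1)^{r'(E)-r'(X)}(y-1)^{|X|-r(X)}z^{(r(E)-r(X))-(r'(E)-r'(X))}$, where $E=E(G)$ is identified with the edge set of the geometric dual $G^*$, $r'=r_G$ is the rank of the cycle matroid $C(G)$, and $r$ is the rank of the bond matroid $B(G^* )=C(G^* )^*$, i.e. $r(X)=|X|+r_{G^*}(E\setminus X)-r_{G^*}(E)$. *)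

theory Defs
  imports "HOL-Computational_Algebra.Polynomial"
begin

text \<open>
  A ribbon graph (equivalently, a graph cellularly embedded in a closed surface) is encoded by
  its flags, in the style of Tutte and Lins.  The flags are the corner points at which edge
  ribbons meet vertex discs, so every edge has four.  The involution \<open>t0\<close> moves along a
  side of an edge ribbon to its other end, \<open>t2\<close> moves across an end of a ribbon, staying at
  the same vertex, and \<open>t1\<close> moves along an arc of the boundary of a vertex disc between
  two cyclically consecutive ribbon ends.  Vertices, edges and faces are the orbits of
  \<open>t1, t2\<close>, of \<open>t0, t2\<close> and of \<open>t0, t1\<close>.
  Vertices without edges have no flags and are listed in \<open>isolated\<close>; each is alone on its
  own sphere component, which has one vertex, no edge and one face.  In particular the one-vertex
  graph in the sphere is covered.  Loops and multiple edges are allowed.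
\<close>

record ('f, 'v) ribbon_graph =
  flags :: "'f set"
  t0 :: "'f \<Rightarrow> 'f"
  t1 :: "'f \<Rightarrow> 'f"
  t2 :: "'f \<Rightarrow> 'f"
  isolated :: "'v set"

definition fixfree_involution_on :: "'f set \<Rightarrow> ('f \<Rightarrow> 'f) \<Rightarrow> bool" where
  "fixfree_involution_on F f \<longleftrightarrow> (\<forall>x\<in>F. f x \<in> F \<and> f x \<noteq> x \<and> f (f x) = x)"

definition is_ribbon_graph :: "('f, 'v) ribbon_graph \<Rightarrow> bool" where
  "is_ribbon_graph G \<longleftrightarrow>
     finite (flags G) \<and> finite (isolated G) \<and>
     fixfree_involution_on (flags G) (t0 G) \<and>
     fixfree_involution_on (flags G) (t1 G) \<and>
     fixfree_involution_on (flags G) (t2 G) \<and>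
     (\<forall>x\<in>flags G. t0 G (t2 G x) = t2 G (t0 G x) \<and> t0 G (t2 G x) \<noteq> x)"

text \<open>Orbits of the group generated by a set \<open>T\<close> of involutions of \<open>F\<close>; being involutions,
  they make the reflexive-transitive closure below an equivalence relation on \<open>F\<close>.\<close>

definition orbits_on :: "'f set \<Rightarrow> ('f \<Rightarrow> 'f) set \<Rightarrow> 'f set set" where
  "orbits_on F T = F // {(x, f x) | x f. x \<in> F \<and> f \<in> T}\<^sup>*"

definition edges :: "('f, 'v) ribbon_graph \<Rightarrow> 'f set set" where
  "edges G = orbits_on (flags G) {t0 G, t2 G}"

definition verts :: "('f, 'v) ribbon_graph \<Rightarrow> ('f set + 'v) set" where
  "verts G = Inl ` orbits_on (flags G) {t1 G, t2 G} \<union> Inr ` isolated G"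

definition incident :: "('f, 'v) ribbon_graph \<Rightarrow> 'f set + 'v \<Rightarrow> 'f set \<Rightarrow> bool" where
  "incident G v e \<longleftrightarrow> v \<in> verts G \<and> (\<exists>w. v = Inl w \<and> w \<inter> e \<noteq> {})"

text \<open>The geometric dual interchanges vertices and faces; it has the same edge set.\<close>

definition dual :: "('f, 'v) ribbon_graph \<Rightarrow> ('f, 'v) ribbon_graph" where
  "dual G = G\<lparr>t0 := t2 G, t2 := t0 G\<rparr>"

lemma edges_dual: "edges (dual G) = edges G"
  by (simp add: edges_def dual_def insert_commute)

lemma is_ribbon_graph_dual:
  assumes "is_ribbon_graph G"
  shows "is_ribbon_graph (dual G)"
  using assms by (auto simp: is_ribbon_graph_def dual_def)

text \<open>The functions $c_G$, $r_G$, $n_G$, for the spanning subgraph with edge set \<open>A\<close>.\<close>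

definition num_comps :: "('f, 'v) ribbon_graph \<Rightarrow> 'f set set \<Rightarrow> nat" where
  "num_comps G A =
     card (verts G // {(u, v). \<exists>e\<in>A. incident G u e \<and> incident G v e}\<^sup>*)"

definition graph_rank :: "('f, 'v) ribbon_graph \<Rightarrow> 'f set set \<Rightarrow> int" where
  "graph_rank G A = int (card (verts G)) - int (num_comps G A)"

definition nullity :: "('f, 'v) ribbon_graph \<Rightarrow> 'f set set \<Rightarrow> int" where
  "nullity G A = int (card A) - graph_rank G A"

text \<open>The number $f_G(A)$ of boundary components of the spanning ribbon subgraph with edge set
  \<open>A\<close>.  Its boundary is traced by alternating arcs of vertex discs (\<open>t1\<close>) with
  sides of ribbons in \<open>A\<close> (\<open>t0\<close>) and, where a ribbon has been deleted, the
  arc of the vertex disc to which it was attached (\<open>t2\<close>).\<close>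

definition along :: "('f, 'v) ribbon_graph \<Rightarrow> 'f set set \<Rightarrow> 'f \<Rightarrow> 'f" where
  "along G A x = (if x \<in> \<Union>A then t0 G x else t2 G x)"

definition num_bdry :: "('f, 'v) ribbon_graph \<Rightarrow> 'f set set \<Rightarrow> nat" where
  "num_bdry G A = card (orbits_on (flags G) {t1 G, along G A}) + card (isolated G)"

text \<open>The surface in which \<open>G\<close> is cellularly embedded is obtained by capping all boundary
  components of the ribbon surface with discs.  It is identified through the classification of
  closed connected surfaces by Euler characteristic and orientability.\<close>

definition surface_connected :: "('f, 'v) ribbon_graph \<Rightarrow> bool" where
  "surface_connected G \<longleftrightarrow>
     card (orbits_on (flags G) {t0 G, t1 G, t2 G}) + card (isolated G) = 1"

definition surface_orientable :: "('f, 'v) ribbon_graph \<Rightarrow> bool" where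
  "surface_orientable G \<longleftrightarrow>
     (\<exists>S. \<forall>x\<in>flags G. \<forall>f\<in>{t0 G, t1 G, t2 G}. f x \<in> S \<longleftrightarrow> x \<notin> S)"

definition surface_euler_char :: "('f, 'v) ribbon_graph \<Rightarrow> int" where
  "surface_euler_char G =
     int (card (verts G)) - int (card (edges G)) + int (num_bdry G (edges G))"

definition in_sphere :: "('f, 'v) ribbon_graph \<Rightarrow> bool" where
  "in_sphere G \<longleftrightarrow>
     surface_connected G \<and> surface_orientable G \<and> surface_euler_char G = 2"

definition in_projective_plane :: "('f, 'v) ribbon_graph \<Rightarrow> bool" where
  "in_projective_plane G \<longleftrightarrow>
     surface_connected G \<and> \<not> surface_orientable G \<and> surface_euler_char G = 1"

definition in_torus :: "('f, 'v) ribbon_graph \<Rightarrow> bool" where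
  "in_torus G \<longleftrightarrow>
     surface_connected G \<and> surface_orientable G \<and> surface_euler_char G = 0"

text \<open>$\mathbf{Z}[x,y,z]$ is represented as $\mathbf{Z}[x][y][z]$, with \<open>z\<close> outermost, so that
  \<open>coeff p i\<close> is the coefficient of $z^i$, a polynomial in \<open>x\<close> and \<open>y\<close>.\<close>

definition varX :: "int poly poly poly" where "varX = [:[:[:0, 1:]:]:]"
definition varY :: "int poly poly poly" where "varY = [:[:0, 1:]:]"
definition varZ :: "int poly poly poly" where "varZ = [:0, 1:]"

definition eval2 :: "int poly poly \<Rightarrow> 'a::comm_ring_1 \<Rightarrow> 'a \<Rightarrow> 'a" where
  "eval2 q x y = poly (map_poly (\<lambda>r. poly (map_poly of_int r) x) q) y"

definition eval3 :: "int poly poly poly \<Rightarrow> 'a::comm_ring_1 \<Rightarrow> 'a \<Rightarrow> 'a \<Rightarrow> 'a" where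
  "eval3 p x y z = poly (map_poly (\<lambda>q. eval2 q x y) p) z"

text \<open>For a ribbon graph all exponents below are nonnegative integers, so \<open>nat\<close> only
  converts the type: the exponent of \<open>z\<close> is the Euler genus of a ribbon subgraph.\<close>

definition bollobas_riordan_poly :: "('f, 'v) ribbon_graph \<Rightarrow> int poly poly poly" where
  "bollobas_riordan_poly G =
     (\<Sum>A\<in>Pow (edges G).
        (varX - 1) ^ nat (graph_rank G (edges G) - graph_rank G A) *
        varY ^ nat (nullity G A) *
        varZ ^ nat (int (num_comps G A) - int (num_bdry G A) + nullity G A))"

definition dual_rank :: "'e set \<Rightarrow> ('e set \<Rightarrow> int) \<Rightarrow> 'e set \<Rightarrow> int" where
  "dual_rank E r X = int (card X) + r (E - X) - r E"

text \<open>The Tutte polynomial of a matroid perspective $M \to M'$ on \<open>E\<close> with rank functions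
  \<open>r\<close> and \<open>r'\<close>.  Here too the exponents are nonnegative, that of \<open>z\<close> by the
  definition of a perspective.\<close>

definition perspective_tutte_poly ::
    "'e set \<Rightarrow> ('e set \<Rightarrow> int) \<Rightarrow> ('e set \<Rightarrow> int) \<Rightarrow> int poly poly poly" where
  "perspective_tutte_poly E r r' =
     (\<Sum>X\<in>Pow E.
        (varX - 1) ^ nat (r' E - r' X) *
        (varY - 1) ^ nat (int (card X) - r X) *
        varZ ^ nat ((r E - r X) - (r' E - r' X)))"

definition las_vergnas_poly :: "('f, 'v) ribbon_graph \<Rightarrow> int poly poly poly" where
  "las_vergnas_poly G =
     perspective_tutte_poly (edges G)
       (dual_rank (edges G) (graph_rank (dual G))) (graph_rank G)"

end

theory Submission
  imports Defs
begin

text \<open>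
  For a connected ribbon graph write $c$, $c^*$ and $f$ for the numbers of components of
  $(V(G), A)$ and of $(V(G^*), E \setminus A)$ and of their common boundary curves.  The substitution
  turns the term of \<open>A\<close> in $R_G$ into $t^{f - 1}$ and that in $L_G$ into
  $t^{c + c^* - 2} z^k$, where Euler's formula gives $k = (\gamma(G) + \gamma^* - \gamma) / 2$ and
  $f = c + c^* - 1 + (\gamma(G) - \gamma - \gamma^*) / 2$ for the Euler genera $\gamma$, $\gamma^*$ of
  the two ribbon subgraphs.  Cutting the surface along the $f$ curves leaves $c + c^*$ pieces, so
  $f \ge c + c^* - 1$ and $\gamma + \gamma^* \le \gamma(G)$.  This forces $f = c + c^* - 1$ in the
  sphere and the projective plane.  In the torus $\gamma$ and $\gamma^*$ are even, which leaves
  $(\gamma, \gamma^*) = (0, 0), (2, 0), (0, 2)$, that is $k = 1, 0, 2$.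
\<close>

section \<open>Counting classes of generated equivalence relations\<close>

text \<open>The converse is built in so that a generating set may list each unordered pair once,
  which keeps the bound of \<open>card_le_num_classes\<close> sharp.\<close>

definition eqv :: "('a \<times> 'a) set \<Rightarrow> ('a \<times> 'a) set" where
  "eqv R = (R \<union> R\<inverse>)\<^sup>*"

definition num_classes :: "'a set \<Rightarrow> ('a \<times> 'a) set \<Rightarrow> nat" where
  "num_classes F R = card (F // eqv R)"

lemma eqv_refl [simp]: "(a, a) \<in> eqv R"
  by (simp add: eqv_def)

lemma eqv_sym: "(a, b) \<in> eqv R \<Longrightarrow> (b, a) \<in> eqv R"
  unfolding eqv_def by (meson sym_Un_converse sym_rtrancl symD)

lemma eqv_trans: "(a, b) \<in> eqv R \<Longrightarrow> (b, c) \<in> eqv R \<Longrightarrow> (a, c) \<in> eqv R"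
  unfolding eqv_def by (rule rtrancl_trans)

lemma eqv_incl: "(a, b) \<in> R \<Longrightarrow> (a, b) \<in> eqv R"
  by (auto simp: eqv_def)

lemma eqv_mono: "R \<subseteq> R' \<Longrightarrow> eqv R \<subseteq> eqv R'"
  unfolding eqv_def by (rule rtrancl_mono) auto

lemma eqv_of_sym: "sym R \<Longrightarrow> eqv R = R\<^sup>*"
  by (simp add: eqv_def sym_conv_converse_eq)

lemma eqv_least: "R \<subseteq> eqv R' \<Longrightarrow> eqv R \<subseteq> eqv R'"
proof -
  assume "R \<subseteq> eqv R'"
  then have "R \<union> R\<inverse> \<subseteq> eqv R'"
    by (auto intro: eqv_sym)
  then show ?thesis
    unfolding eqv_def by (rule rtrancl_subset_rtrancl)
qed

lemma eqv_invariant: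
  assumes "(a, b) \<in> eqv R"
    and "\<And>u v. (u, v) \<in> R \<Longrightarrow> Q u \<longleftrightarrow> Q v" and "Q a"
  shows "Q b"
  using assms(1) unfolding eqv_def
  by (induction rule: rtrancl_induct) (use assms(2,3) in auto)

lemma eqv_class_eq: "eqv R `` {a} = eqv R `` {b} \<longleftrightarrow> (a, b) \<in> eqv R"
  by (auto intro: eqv_sym eqv_trans)

text \<open>A path that uses the new pair several times can be shortened to one that uses it at most
  once, in one of its two directions.\<close>

lemma eqv_insert:
  "(a, b) \<in> eqv (insert (x, y) R) \<longleftrightarrow>
     (a, b) \<in> eqv R \<or> (a, x) \<in> eqv R \<and> (y, b) \<in> eqv R \<or> (a, y) \<in> eqv R \<and> (x, b) \<in> eqv R"
proof -
  have "insert (x, y) R \<union> (insert (x, y) R)\<inverse> = insert (x, y) (insert (y, x) (R \<union> R\<inverse>))"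
    by auto
  then have *: "eqv (insert (x, y) R) = (insert (x, y) (insert (y, x) (R \<union> R\<inverse>)))\<^sup>*"
    by (simp add: eqv_def)
  show ?thesis
    unfolding * rtrancl_insert eqv_def[symmetric]
    using eqv_trans[of a x R b] eqv_trans[of a y R b] by auto
qed

lemma eqv_insert_redundant: "(x, y) \<in> eqv R \<Longrightarrow> eqv (insert (x, y) R) = eqv R"
  by (intro equalityI eqv_least) (auto intro: eqv_incl)

lemma eqv_two_pairs:
  "eqv (R \<union> {(a, b), (b, a), (c, d), (d, c)}) = eqv (insert (c, d) (insert (a, b) R))"
  unfolding eqv_def by (intro arg_cong[where f = rtrancl]) auto

text \<open>The classes of \<open>x\<close> and \<open>y\<close> fuse and all other classes survive
  unchanged.\<close>

lemma num_classes_insert_new: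
  assumes "finite F" "x \<in> F" "y \<in> F" "(x, y) \<notin> eqv R"
  shows "num_classes F R = Suc (num_classes F (insert (x, y) R))"
proof -
  let ?r = "eqv R" and ?r' = "eqv (insert (x, y) R)"
  let ?X = "?r `` {x}" and ?Y = "?r `` {y}"
  have merged: "?r' `` {a} = ?X \<union> ?Y" if a: "a \<in> ?X \<union> ?Y" for a
    using a
  proof
    assume "a \<in> ?X"
    then have *: "(x, a) \<in> ?r" "(a, x) \<in> ?r"
      using eqv_sym[of x a R] by simp_all
    then have eq: "(a, b) \<in> ?r \<longleftrightarrow> (x, b) \<in> ?r" for b
      using eqv_trans[of a x R b] eqv_trans[of x a R b] by blast
    show ?thesis
      by (auto simp: eqv_insert eq)
  next
    assume "a \<in> ?Y"
    then have *: "(y, a) \<in> ?r" "(a, y) \<in> ?r"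
      using eqv_sym[of y a R] by simp_all
    then have eq: "(a, b) \<in> ?r \<longleftrightarrow> (y, b) \<in> ?r" for b
      using eqv_trans[of a y R b] eqv_trans[of y a R b] by blast
    show ?thesis
      by (auto simp: eqv_insert eq)
  qed
  have kept: "?r' `` {a} = ?r `` {a}" if "a \<notin> ?X \<union> ?Y" for a
    using that eqv_sym[of a x R] eqv_sym[of a y R] by (auto simp: eqv_insert)
  have ne: "?X \<noteq> ?Y"
    using assms(4) by (simp add: eqv_class_eq)
  have in_class: "?r `` {a} \<in> {?X, ?Y} \<longleftrightarrow> a \<in> ?X \<union> ?Y" for a
    using eqv_sym[of a x R] eqv_sym[of x a R] eqv_sym[of a y R] eqv_sym[of y a R]
    by (auto simp: eqv_class_eq)
  have quot: "F // ?r' = insert (?X \<union> ?Y) (F // ?r - {?X, ?Y})"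
  proof (intro equalityI subsetI)
    fix c assume "c \<in> F // ?r'"
    then obtain a where a: "a \<in> F" "c = ?r' `` {a}"
      by (auto simp: quotient_def)
    show "c \<in> insert (?X \<union> ?Y) (F // ?r - {?X, ?Y})"
    proof (cases "a \<in> ?X \<union> ?Y")
      case True
      then show ?thesis using merged a by simp
    next
      case False
      then have "c = ?r `` {a}" "?r `` {a} \<notin> {?X, ?Y}"
        using kept a in_class by blast+
      then show ?thesis
        using a(1) by (auto simp: quotient_def)
    qed
  next
    fix c assume c: "c \<in> insert (?X \<union> ?Y) (F // ?r - {?X, ?Y})"
    show "c \<in> F // ?r'"
    proof (cases "c = ?X \<union> ?Y")
      case True
      then show ?thesis
        using merged[of x] assms(2) by (auto simp: quotient_def)
    next
      case False
      then obtain a where a: "a \<in> F" "c = ?r `` {a}" "c \<notin> {?X, ?Y}"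
        using c by (auto simp: quotient_def)
      then have "c = ?r' `` {a}"
        using kept in_class by blast
      then show ?thesis
        using a(1) by (auto simp: quotient_def)
    qed
  qed
  have fin: "finite (F // ?r)"
    using assms(1) by (simp add: quotient_def)
  have sub: "{?X, ?Y} \<subseteq> F // ?r"
    using assms(2,3) by (auto simp: quotient_def)
  \<comment> \<open>Without this the fused class might already be among the surviving ones, and the
    count would drop by two.\<close>
  have new: "?X \<union> ?Y \<notin> F // ?r"
  proof
    assume "?X \<union> ?Y \<in> F // ?r"
    then obtain a where a: "?X \<union> ?Y = ?r `` {a}"
      by (auto simp: quotient_def)
    have "x \<in> ?X \<union> ?Y" "y \<in> ?X \<union> ?Y"
      by simp_all
    then have "x \<in> ?r `` {a}" "y \<in> ?r `` {a}"
      by (simp_all only: a)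
    then show False
      using assms(4) eqv_sym[of a x R] eqv_trans[of x a R y] by auto
  qed
  have "card (F // ?r - {?X, ?Y}) + 2 = card (F // ?r)"
    using card_Diff_subset[OF _ sub] card_mono[OF fin sub] ne by simp
  then show ?thesis
    using fin new by (simp add: num_classes_def quot)
qed

lemma num_classes_insert:
  assumes "finite F" "x \<in> F" "y \<in> F"
  shows "num_classes F R =
    num_classes F (insert (x, y) R) + (if (x, y) \<in> eqv R then 0 else 1)"
  using eqv_insert_redundant[of x y R] num_classes_insert_new[OF assms, of R]
  by (auto simp: num_classes_def)

text \<open>The rank \<open>card F - num_classes F R\<close> is that of a graphic matroid.\<close>

lemma num_classes_submodular:
  assumes "finite F" "finite D" "D \<subseteq> F \<times> F" "B \<subseteq> C"
  shows "num_classes F C + num_classes F (B \<union> D) \<le> num_classes F B + num_classes F (C \<union> D)"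
  using assms(2,3)
proof (induction D rule: finite_induct)
  case (insert p D)
  obtain x y where p: "p = (x, y)" "x \<in> F" "y \<in> F"
    using insert.prems by auto
  \<comment> \<open>Diminishing returns: a pair that still fuses two classes over
    \<open>C \<union> D\<close> also does so over the finer relation of
    \<open>B \<union> D\<close>.\<close>
  have "eqv (B \<union> D) \<subseteq> eqv (C \<union> D)"
    using assms(4) by (intro eqv_mono) auto
  then show ?case
    using insert p num_classes_insert[OF assms(1) p(2,3), of "B \<union> D"]
      num_classes_insert[OF assms(1) p(2,3), of "C \<union> D"]
    by (auto split: if_splits)
qed auto

lemma num_classes_antimono:
  assumes "finite F" "finite D" "D \<subseteq> F \<times> F" "B \<subseteq> D"
  shows "num_classes F D \<le> num_classes F B"
proof -
  have "num_classes F D + num_classes F (B \<union> D) \<le> num_classes F B + num_classes F (D \<union> D)"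
    using assms by (intro num_classes_submodular)
  moreover have "B \<union> D = D"
    using assms(4) by auto
  ultimately show ?thesis by simp
qed

text \<open>Starting from singletons, each pair removes at most one class; so connecting
  \<open>n\<close> points takes at least \<open>n - 1\<close> pairs.\<close>

lemma card_le_num_classes:
  assumes "finite F" "finite R" "R \<subseteq> F \<times> F"
  shows "card F \<le> num_classes F R + card R"
  using assms(2,3)
proof (induction R rule: finite_induct)
  case empty
  have "F // eqv {} = (\<lambda>x. {x}) ` F"
    by (auto simp: eqv_def quotient_def)
  then show ?case
    by (simp add: num_classes_def card_image)
next
  case (insert p R)
  then obtain x y where p: "p = (x, y)" "x \<in> F" "y \<in> F"
    by auto
  then show ?case
    using insert num_classes_insert[OF assms(1) p(2,3), of R] by (auto split: if_splits)
qed

section \<open>Involutions, fibres and graphs of functions\<close>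

lemma even_card_fixfree_involution:
  assumes "finite K" "fixfree_involution_on K f"
  shows "even (card K)"
  using assms
proof (induction K rule: finite_psubset_induct)
  case (psubset K)
  show ?case
  proof (cases "K = {}")
    case False
    then obtain x where x: "x \<in> K" by auto
    let ?K = "K - {x, f x}"
    have fx: "f x \<in> K" "f x \<noteq> x" "f (f x) = x"
      using psubset.prems x by (auto simp: fixfree_involution_on_def)
    have "f y \<in> ?K" if "y \<in> ?K" for y
    proof -
      have "f y \<in> K" "f (f y) = y"
        using psubset.prems that by (auto simp: fixfree_involution_on_def)
      moreover have "f y \<noteq> x" "f y \<noteq> f x"
        using calculation that fx by auto
      ultimately show ?thesis by simp
    qed
    then have "fixfree_involution_on ?K f"
      using psubset.prems by (auto simp: fixfree_involution_on_def)
    moreover have "?K \<subset> K"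
      using x by auto
    ultimately have "even (card ?K)"
      using psubset.IH by blast
    moreover have "card K = card ?K + 2"
      using card_Diff_subset[of "{x, f x}" K] card_mono[of K "{x, f x}"] x fx psubset.hyps by auto
    ultimately show ?thesis by simp
  qed simp
qed

text \<open>Both maps have the same fibres on \<open>F\<close>, so sending a value of
  \<open>f\<close> to the value of \<open>g\<close> at any chosen preimage is a bijection.\<close>

lemma card_image_cong_eq:
  assumes "\<And>x y. x \<in> F \<Longrightarrow> y \<in> F \<Longrightarrow> f x = f y \<longleftrightarrow> g x = g y"
  shows "card (f ` F) = card (g ` F)"
proof (rule bij_betw_same_card)
  let ?h = "\<lambda>c. g (SOME x. x \<in> F \<and> f x = c)"
  have h: "?h (f x) = g x" if "x \<in> F" for x
  proof -
    have "(SOME y. y \<in> F \<and> f y = f x) \<in> F \<and> f (SOME y. y \<in> F \<and> f y = f x) = f x"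
      by (rule someI[of "\<lambda>y. y \<in> F \<and> f y = f x" x]) (use that in auto)
    then show ?thesis
      using assms that by blast
  qed
  show "bij_betw ?h (f ` F) (g ` F)"
    unfolding bij_betw_def inj_on_def
  proof (intro conjI ballI impI)
    show "?h ` f ` F = g ` F"
      unfolding image_image using h by (intro image_cong) auto
  next
    fix c d assume "c \<in> f ` F" "d \<in> f ` F" "?h c = ?h d"
    then show "c = d" using assms h by auto
  qed
qed

lemma num_classes_eqvI: "eqv R = eqv R' \<Longrightarrow> num_classes F R = num_classes F R'"
  by (simp add: num_classes_def)

definition gr :: "('a \<Rightarrow> 'a) \<Rightarrow> 'a set \<Rightarrow> ('a \<times> 'a) set" where
  "gr f K = (\<lambda>x. (x, f x)) ` K"

lemma gr_iff: "(a, b) \<in> gr f K \<longleftrightarrow> a \<in> K \<and> b = f a"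
  by (auto simp: gr_def)

lemma sym_gr: "(\<And>x. x \<in> K \<Longrightarrow> f x \<in> K \<and> f (f x) = x) \<Longrightarrow> sym (gr f K)"
  unfolding sym_def gr_iff by metis

lemma gr_mono: "K \<subseteq> L \<Longrightarrow> gr f K \<subseteq> gr f L"
  by (auto simp: gr_def)

section \<open>Components and boundary curves as classes of flags\<close>

locale ribbon =
  fixes G :: "('f, 'v) ribbon_graph"
  assumes ribbon: "is_ribbon_graph G"
begin

abbreviation "F \<equiv> flags G"

lemma finite_flags [simp]: "finite F" and finite_isolated [simp]: "finite (isolated G)"
  using ribbon by (auto simp: is_ribbon_graph_def)

lemma t_flags [simp]:
  "x \<in> F \<Longrightarrow> t0 G x \<in> F" "x \<in> F \<Longrightarrow> t1 G x \<in> F" "x \<in> F \<Longrightarrow> t2 G x \<in> F"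
  and t_neq [simp]:
  "x \<in> F \<Longrightarrow> t0 G x \<noteq> x" "x \<in> F \<Longrightarrow> t1 G x \<noteq> x" "x \<in> F \<Longrightarrow> t2 G x \<noteq> x"
  and t_idem [simp]:
  "x \<in> F \<Longrightarrow> t0 G (t0 G x) = x" "x \<in> F \<Longrightarrow> t1 G (t1 G x) = x" "x \<in> F \<Longrightarrow> t2 G (t2 G x) = x"
  and t0_t2: "x \<in> F \<Longrightarrow> t0 G (t2 G x) = t2 G (t0 G x)"
  and t0_t2_neq: "x \<in> F \<Longrightarrow> t0 G (t2 G x) \<noteq> x"
  using ribbon by (auto simp: is_ribbon_graph_def fixfree_involution_on_def)

lemma t2_t0_neq [simp]: "x \<in> F \<Longrightarrow> t2 G (t0 G x) \<noteq> x"
  using t0_t2 t0_t2_neq by metis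

lemma t0_neq_t2 [simp]: "x \<in> F \<Longrightarrow> t0 G x \<noteq> t2 G x"
  by (metis t0_t2_neq t_idem(1))

section \<open>Edges as sets of four flags\<close>

definition edge_of :: "'f \<Rightarrow> 'f set" where
  "edge_of x = {x, t0 G x, t2 G x, t2 G (t0 G x)}"

lemma orbits_on_pair:
  assumes "\<And>x. x \<in> F \<Longrightarrow> f x \<in> F \<and> f (f x) = x" "\<And>x. x \<in> F \<Longrightarrow> g x \<in> F \<and> g (g x) = x"
  shows "orbits_on F {f, g} = F // eqv (gr f F \<union> gr g F)"
proof -
  have "{(x, h x) | x h. x \<in> F \<and> h \<in> {f, g}} = gr f F \<union> gr g F"
    by (auto simp: gr_def)
  moreover have "sym (gr f F \<union> gr g F)"
    using assms by (intro sym_Un sym_gr) auto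
  ultimately show ?thesis
    by (simp add: orbits_on_def eqv_of_sym)
qed

lemma edge_of_self [simp]: "x \<in> edge_of x"
  by (simp add: edge_of_def)

text \<open>As \<open>t0\<close> and \<open>t2\<close> are commuting involutions, the four flags
  listed in \<open>edge_of x\<close> are closed under both.\<close>

lemma edge_class:
  assumes "x \<in> F"
  shows "eqv (gr (t0 G) F \<union> gr (t2 G) F) `` {x} = edge_of x"
proof (intro equalityI subsetI)
  fix y assume "y \<in> eqv (gr (t0 G) F \<union> gr (t2 G) F) `` {x}"
  then have "(x, y) \<in> eqv (gr (t0 G) F \<union> gr (t2 G) F)"
    by simp
  moreover have "u \<in> edge_of x \<longleftrightarrow> v \<in> edge_of x"
    if "(u, v) \<in> gr (t0 G) F \<union> gr (t2 G) F" for u v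
  proof -
    have "t0 G w \<in> edge_of x" "t2 G w \<in> edge_of x" if "w \<in> edge_of x" for w
      using that assms by (auto simp: edge_of_def t0_t2)
    moreover have "(u, v) \<in> gr (t0 G) F \<or> (u, v) \<in> gr (t2 G) F"
      using that by auto
    ultimately show ?thesis
      by (metis gr_iff t_idem(1,3))
  qed
  ultimately show "y \<in> edge_of x"
    by (rule eqv_invariant[where Q = "\<lambda>y. y \<in> edge_of x"]) simp_all
next
  fix y assume "y \<in> edge_of x"
  moreover have "(x, t0 G x) \<in> eqv (gr (t0 G) F \<union> gr (t2 G) F)"
    "(x, t2 G x) \<in> eqv (gr (t0 G) F \<union> gr (t2 G) F)"
    "(t0 G x, t2 G (t0 G x)) \<in> eqv (gr (t0 G) F \<union> gr (t2 G) F)"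
    using assms by (auto intro!: eqv_incl simp: gr_iff)
  ultimately show "y \<in> eqv (gr (t0 G) F \<union> gr (t2 G) F) `` {x}"
    by (auto simp: edge_of_def intro: eqv_trans)
qed

lemma edges_eq: "edges G = edge_of ` F"
  by (auto simp: edges_def orbits_on_pair quotient_def edge_class)

lemma edge_of_eq:
  assumes "x \<in> F" "y \<in> edge_of x"
  shows "edge_of y = edge_of x" "y \<in> F"
  using assms by (auto simp: edge_of_def t0_t2)

lemma edgeE:
  assumes "e \<in> edges G" "x \<in> e"
  shows "x \<in> F" "e = edge_of x"
  using assms edge_of_eq unfolding edges_eq by blast+

lemma finite_edges [simp]: "finite (edges G)"
  by (simp add: edges_eq)

lemma Union_edges: "\<Union>(edges G) = F"
  using edge_of_eq(2) edge_of_self unfolding edges_eq by blast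

lemma in_Union_iff: "A \<subseteq> edges G \<Longrightarrow> x \<in> \<Union>A \<longleftrightarrow> edge_of x \<in> A"
  using edgeE(2) edge_of_self by blast

lemma Union_subset: "A \<subseteq> edges G \<Longrightarrow> \<Union>A \<subseteq> F"
  using Union_edges by auto

lemma edge_of_t [simp]:
  assumes "x \<in> F"
  shows "edge_of (t0 G x) = edge_of x" "edge_of (t2 G x) = edge_of x"
  by (rule edge_of_eq[OF assms], simp add: edge_of_def)+

lemma Union_t:
  assumes "A \<subseteq> edges G" "x \<in> F"
  shows "t0 G x \<in> \<Union>A \<longleftrightarrow> x \<in> \<Union>A" "t2 G x \<in> \<Union>A \<longleftrightarrow> x \<in> \<Union>A"
  using assms by (simp_all only: in_Union_iff edge_of_t)

lemma gr_subset: "K \<subseteq> F \<Longrightarrow> gr (t0 G) K \<subseteq> F \<times> F" "K \<subseteq> F \<Longrightarrow> gr (t1 G) K \<subseteq> F \<times> F"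
    "K \<subseteq> F \<Longrightarrow> gr (t2 G) K \<subseteq> F \<times> F"
  by (auto simp: gr_def)

text \<open>Here \<open>t1\<close> and \<open>t2\<close> connect the flags of one vertex and
  \<open>t0\<close> joins the two ends of an edge of \<open>A\<close>. Components, dual components
  and boundary curves thus all become classes on the one ground set \<open>F\<close>, where
  submodularity can compare them.\<close>

definition comp_rel :: "'f set set \<Rightarrow> ('f \<times> 'f) set" where
  "comp_rel A = gr (t1 G) F \<union> gr (t2 G) F \<union> gr (t0 G) (\<Union>A)"

definition bdry_rel :: "'f set set \<Rightarrow> ('f \<times> 'f) set" where
  "bdry_rel A = gr (t1 G) F \<union> gr (t0 G) (\<Union>A) \<union> gr (t2 G) (F - \<Union>A)"

lemma card_verts: "card (verts G) = num_classes F (comp_rel {}) + card (isolated G)"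
proof -
  have "card (verts G) = card (Inl ` orbits_on F {t1 G, t2 G} :: ('f set + 'v) set)
      + card (Inr ` isolated G :: ('f set + 'v) set)"
    unfolding verts_def
    by (intro card_Un_disjoint) (auto simp: orbits_on_def quotient_def)
  then show ?thesis
    by (simp add: card_image orbits_on_pair num_classes_def comp_rel_def gr_def[of _ "{}"])
qed

lemma along_flags:
  assumes "A \<subseteq> edges G" "x \<in> F"
  shows "along G A x \<in> F" "along G A (along G A x) = x" "along G A x \<noteq> x"
  using assms Union_t[OF assms] by (auto simp: along_def)

lemma bdry_rel_along:
  assumes "A \<subseteq> edges G"
  shows "bdry_rel A = gr (t1 G) F \<union> gr (along G A) F"
  using Union_subset[OF assms]
  by (intro equalityI subrelI) (auto simp: bdry_rel_def gr_iff along_def split: if_splits)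

lemma num_bdry_eq:
  assumes "A \<subseteq> edges G"
  shows "num_bdry G A = num_classes F (bdry_rel A) + card (isolated G)"
  using along_flags[OF assms]
  by (simp add: num_bdry_def orbits_on_pair bdry_rel_along[OF assms] num_classes_def)

text \<open>Walks between vertices lift to walks between flags because the flags of an edge in
  \<open>A\<close> are all connected; conversely, each generating pair of flags stays at a vertex or
  crosses an edge of \<open>A\<close>. Isolated vertices carry no flags and are counted
  apart.\<close>

lemma num_comps_eq:
  assumes "A \<subseteq> edges G"
  shows "num_comps G A = num_classes F (comp_rel A) + card (isolated G)"
proof -
  define W where "W = eqv (gr (t1 G) F \<union> gr (t2 G) F)"
  define I where "I = {(u, v). \<exists>e\<in>A. incident G u e \<and> incident G v e}"
  \<comment> \<open>The vertex at which the flag \<open>x\<close> lies.\<close>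
  define \<phi> where "\<phi> x = (Inl (W `` {x}) :: 'f set + 'v)" for x
  have verts: "verts G = \<phi> ` F \<union> Inr ` isolated G"
    by (auto simp: verts_def orbits_on_pair quotient_def \<phi>_def W_def)
  have "sym I"
    by (auto simp: sym_def I_def)
  then have I: "I\<^sup>* = eqv I"
    by (simp add: eqv_of_sym)
  have W_sub: "W \<subseteq> eqv (comp_rel A)"
    unfolding W_def by (rule eqv_mono) (auto simp: comp_rel_def)
  have incident: "incident G (\<phi> x) e \<longleftrightarrow> (\<exists>y\<in>e. (x, y) \<in> W)" if "x \<in> F" for x e
    using that by (auto simp: incident_def verts \<phi>_def)
  have same_edge: "(y, z) \<in> eqv (comp_rel A)" if "e \<in> A" "y \<in> e" "z \<in> e" for e y z
  proof -
    have "e \<in> edges G"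
      using assms that(1) by blast
    then have y: "y \<in> F" "e = edge_of y" "y \<in> \<Union>A"
      using edgeE[of e y] that by blast+
    then have "(y, t0 G y) \<in> eqv (comp_rel A)" "(y, t2 G y) \<in> eqv (comp_rel A)"
      "(t0 G y, t2 G (t0 G y)) \<in> eqv (comp_rel A)"
      by (auto intro!: eqv_incl simp: comp_rel_def gr_iff)
    then show ?thesis
      using that(3) eqv_trans[of y "t0 G y" "comp_rel A"] unfolding y(2) edge_of_def by auto
  qed
  have forward: "\<exists>y\<in>F. u = \<phi> y \<and> (x, y) \<in> eqv (comp_rel A)" if "(\<phi> x, u) \<in> I\<^sup>*" "x \<in> F" for x u
    using that(1)
  proof (induction rule: rtrancl_induct)
    case base
    show ?case using that(2) by (intro bexI[of _ x]) simp_all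
  next
    case (step u v)
    then obtain y where y: "y \<in> F" "u = \<phi> y" "(x, y) \<in> eqv (comp_rel A)"
      by blast
    obtain e where e: "e \<in> A" "incident G u e" "incident G v e"
      using step.hyps(2) unfolding I_def by blast
    obtain w where w: "w \<in> F" "v = \<phi> w"
      using e(3) by (auto simp: incident_def verts)
    obtain y' where y': "y' \<in> e" "(y, y') \<in> eqv (comp_rel A)"
      using e(2) W_sub unfolding y(2) incident[OF y(1)] by blast
    obtain w' where w': "w' \<in> e" "(w, w') \<in> eqv (comp_rel A)"
      using e(3) W_sub unfolding w(2) incident[OF w(1)] by blast
    \<comment> \<open>From \<open>y\<close> the walk goes round its vertex to the flag
      \<open>y'\<close> of \<open>e\<close>, over \<open>e\<close> to \<open>w'\<close>, and round
      the next vertex to \<open>w\<close>.\<close>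
    have "(x, w) \<in> eqv (comp_rel A)"
      by (intro eqv_trans[OF y(3)] eqv_trans[OF y'(2)] eqv_trans[OF same_edge[OF e(1) y'(1) w'(1)]]
          eqv_sym[OF w'(2)])
    then show ?case
      using w by blast
  qed
  have backward: "(\<phi> x, \<phi> y) \<in> I\<^sup>*" if "(x, y) \<in> eqv (comp_rel A)" for x y
    using that
  proof (rule eqv_invariant[where Q = "\<lambda>y. (\<phi> x, \<phi> y) \<in> I\<^sup>*"])
    fix u v assume uv: "(u, v) \<in> comp_rel A"
    have "(\<phi> u, \<phi> v) \<in> eqv I"
    proof (cases "(u, v) \<in> gr (t0 G) (\<Union>A)")
      case True
      then obtain e where e: "e \<in> A" "u \<in> e" "v = t0 G u"
        by (auto simp: gr_iff)
      have "e \<in> edges G"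
        using e(1) assms by blast
      then have "u \<in> F" "v \<in> F" "v \<in> e"
        using edgeE[of e u] e(2,3) by (auto simp: edge_of_def)
      then have "incident G (\<phi> u) e" "incident G (\<phi> v) e"
        using e(2) \<open>v \<in> e\<close> \<open>u \<in> F\<close> \<open>v \<in> F\<close> eqv_refl[of u] eqv_refl[of v]
        unfolding W_def incident[OF \<open>u \<in> F\<close>] incident[OF \<open>v \<in> F\<close>] by blast+
      then have "(\<phi> u, \<phi> v) \<in> I"
        using e(1) unfolding I_def by blast
      then show ?thesis by (rule eqv_incl)
    next
      case False
      then have "(u, v) \<in> W"
        using uv unfolding W_def by (intro eqv_incl) (auto simp: comp_rel_def)
      then have "\<phi> u = \<phi> v"
        by (simp add: \<phi>_def W_def eqv_class_eq)
      then show ?thesis by simp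
    qed
    then show "((\<phi> x, \<phi> u) \<in> I\<^sup>*) = ((\<phi> x, \<phi> v) \<in> I\<^sup>*)"
      unfolding I by (meson eqv_sym eqv_trans)
  qed simp
  have iso: "eqv I `` {Inr v} = {Inr v}" for v :: 'v
  proof -
    have "u = Inr v" if "(Inr v, u) \<in> eqv I" for u
      using that by (rule eqv_invariant[where Q = "\<lambda>u. u = Inr v"]) (auto simp: I_def incident_def)
    then show ?thesis by auto
  qed
  have "verts G // I\<^sup>* = (\<lambda>x. eqv I `` {\<phi> x}) ` F \<union> (\<lambda>v. {Inr v}) ` isolated G"
    unfolding I quotient_def verts by (auto simp: iso)
  moreover have "(\<lambda>x. eqv I `` {\<phi> x}) ` F \<inter> (\<lambda>v. {Inr v}) ` isolated G = {}"
  proof -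
    have "\<phi> x \<in> eqv I `` {\<phi> x}" for x
      by simp
    moreover have "\<phi> x \<noteq> Inr v" for x v
      by (simp add: \<phi>_def)
    ultimately have "eqv I `` {\<phi> x} \<noteq> {Inr v}" for x v
      by (metis singletonD)
    then show ?thesis by auto
  qed
  ultimately have "num_comps G A = card ((\<lambda>x. eqv I `` {\<phi> x}) ` F) + card (isolated G)"
    unfolding num_comps_def I_def[symmetric]
    by (simp add: card_Un_disjoint card_image inj_on_def)
  also have "card ((\<lambda>x. eqv I `` {\<phi> x}) ` F) = card ((\<lambda>x. eqv (comp_rel A) `` {x}) ` F)"
  proof (rule card_image_cong_eq)
    fix x y assume xy: "x \<in> F" "y \<in> F"
    have "(x, y) \<in> eqv (comp_rel A)" if xy': "(\<phi> x, \<phi> y) \<in> I\<^sup>*"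
    proof -
      obtain z where "z \<in> F" "\<phi> y = \<phi> z" "(x, z) \<in> eqv (comp_rel A)"
        using forward[OF xy' xy(1)] by auto
      moreover have "(y, z) \<in> W"
        using calculation(2) by (simp add: \<phi>_def W_def eqv_class_eq)
      ultimately show ?thesis
        using W_sub by (blast intro: eqv_trans eqv_sym)
    qed
    then show "eqv I `` {\<phi> x} = eqv I `` {\<phi> y} \<longleftrightarrow> eqv (comp_rel A) `` {x} = eqv (comp_rel A) `` {y}"
      using backward[of x y] by (auto simp: eqv_class_eq I)
  qed
  also have "\<dots> = num_classes F (comp_rel A)"
    unfolding num_classes_def quotient_def by (intro arg_cong[where f = card]) auto
  finally show ?thesis .
qed

end

section \<open>Adding one edge\<close>

lemma eqv_class_closed: "(u, v) \<in> R \<Longrightarrow> u \<in> eqv R `` {a} \<longleftrightarrow> v \<in> eqv R `` {a}"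
  using eqv_trans[of a u R v] eqv_trans[of a v R u] eqv_incl[of u v R] eqv_sym[of u v R] by auto

lemma eqv_class_subset:
  assumes "R \<subseteq> F \<times> F" "a \<in> F"
  shows "eqv R `` {a} \<subseteq> F"
proof
  fix y assume "y \<in> eqv R `` {a}"
  then have "(a, y) \<in> eqv R" by simp
  then show "y \<in> F"
    by (rule eqv_invariant[where Q = "\<lambda>y. y \<in> F"]) (use assms in auto)
qed

context ribbon
begin

text \<open>Boundary tracing with the flags of \<open>e\<close> left open: the part common to the
  boundary relations with and without \<open>e\<close>. Its classes are closed curves and arcs whose
  ends are the flags of \<open>e\<close>.\<close>

definition rest_rel :: "'f set set \<Rightarrow> 'f set \<Rightarrow> ('f \<times> 'f) set" where
  "rest_rel A e = gr (t1 G) F \<union> gr (along G A) (F - e)"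

lemma rest_rel_subset: "A \<subseteq> edges G \<Longrightarrow> rest_rel A e \<subseteq> F \<times> F"
  using along_flags by (auto simp: rest_rel_def gr_def)

lemma along_not_in_edge:
  assumes "A \<subseteq> edges G" "e \<in> edges G" "y \<in> F - e"
  shows "along G A y \<in> F - e"
proof -
  have "t0 G y \<notin> e" "t2 G y \<notin> e"
    using Union_t[of "{e}" y] assms by auto
  then show ?thesis
    using along_flags[OF assms(1)] assms(3) by (auto simp: along_def)
qed

lemma rest_class_closed:
  assumes A: "A \<subseteq> edges G" and e: "e \<in> edges G" and a: "a \<in> F"
    and y: "y \<in> eqv (rest_rel A e) `` {a}"
  shows "y \<in> F" "t1 G y \<in> eqv (rest_rel A e) `` {a}"
    "y \<notin> e \<Longrightarrow> along G A y \<in> eqv (rest_rel A e) `` {a} - e"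
proof -
  show yF: "y \<in> F"
    using eqv_class_subset[OF rest_rel_subset[OF A] a] y by blast
  then have "(y, t1 G y) \<in> rest_rel A e"
    by (simp add: rest_rel_def gr_iff)
  from eqv_class_closed[OF this] y show "t1 G y \<in> eqv (rest_rel A e) `` {a}"
    by (rule iffD1)
  assume ye: "y \<notin> e"
  with yF have "(y, along G A y) \<in> rest_rel A e"
    by (simp add: rest_rel_def gr_iff)
  from eqv_class_closed[OF this] y have "along G A y \<in> eqv (rest_rel A e) `` {a}"
    by (rule iffD1)
  then show "along G A y \<in> eqv (rest_rel A e) `` {a} - e"
    using along_not_in_edge[OF A e, of y] yF ye by simp
qed

lemma rest_class_even:
  assumes A: "A \<subseteq> edges G" and e: "e \<in> edges G" and a: "a \<in> F"
  shows "even (card (eqv (rest_rel A e) `` {a} \<inter> e))"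
proof -
  define K where "K = eqv (rest_rel A e) `` {a}"
  note closed = rest_class_closed[OF A e a, folded K_def]
  have K: "K \<subseteq> F"
    using closed(1) by blast
  then have fin: "finite K"
    using finite_flags finite_subset by blast
  have closed1: "t1 G y \<in> K" if "y \<in> K" for y
    using closed(2)[OF that] .
  have closed2: "along G A y \<in> K - e" if "y \<in> K - e" for y
    using closed(3)[of y] that by blast
  \<comment> \<open>\<open>t1\<close> pairs up the flags of \<open>K\<close>, and \<open>along\<close> pairs up those outside \<open>e\<close>.\<close>
  have "even (card K)"
    using K closed1 by (intro even_card_fixfree_involution[OF fin, of "t1 G"])
      (auto simp: fixfree_involution_on_def)
  moreover have "even (card (K - e))"
    using K closed2 along_flags[OF A] fin
    by (intro even_card_fixfree_involution[of _ "along G A"])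
      (auto simp: fixfree_involution_on_def)
  moreover have "card K = card (K - e) + card (K \<inter> e)"
    using fin by (metis Int_commute add.commute card_Diff_subset_Int card_Int_Diff)
  ultimately show ?thesis
    by (simp add: K_def)
qed

text \<open>The class of \<open>a\<close> meets \<open>e\<close> in an even number of flags, hence
  not in \<open>a\<close> alone.\<close>

lemma rest_partner:
  assumes A: "A \<subseteq> edges G" and e: "e \<in> edges G" and a: "a \<in> e"
  shows "\<exists>b\<in>e. b \<noteq> a \<and> (a, b) \<in> eqv (rest_rel A e)"
proof (rule ccontr)
  assume "\<not> ?thesis"
  then have "eqv (rest_rel A e) `` {a} \<inter> e = {a}"
    using a by auto
  moreover have "a \<in> F"
    using edgeE[OF e a] by simp
  ultimately show False
    using rest_class_even[OF A e] by fastforce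
qed

end

section \<open>The effect of one edge on components and boundary curves\<close>

locale ribbon_edge = ribbon G for G :: "('f, 'v) ribbon_graph" +
  fixes A e x
  assumes A: "A \<subseteq> edges G" and e: "e \<in> edges G" and new: "e \<notin> A" and x: "x \<in> e"
begin

abbreviation "x0 \<equiv> t0 G x"
abbreviation "x2 \<equiv> t2 G x"
abbreviation "x3 \<equiv> t2 G (t0 G x)"
abbreviation "P \<equiv> rest_rel A e"

lemma xF [simp]: "x \<in> F"
  using edgeE[OF e x] by simp

lemma e_eq: "e = {x, x0, x2, x3}"
  using edgeE(2)[OF e x] by (simp add: edge_of_def)

lemma insert_edges: "insert e A \<subseteq> edges G"
  using A e by auto

lemma e_disjoint: "y \<in> e \<Longrightarrow> y \<notin> \<Union>A"
  using in_Union_iff[OF A] edgeE(2)[OF e] new by metis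

lemma along_edge: "y \<in> e \<Longrightarrow> along G A y = t2 G y"
  using e_disjoint by (simp add: along_def)

lemma along_insert: "along G (insert e A) y = (if y \<in> e then t0 G y else along G A y)"
  by (auto simp: along_def)

text \<open>The open ends at \<open>e\<close> are closed up along the vertex discs if the ribbon is
  absent and along its two sides if it is present.\<close>

lemma bdry_rel_split:
  "bdry_rel A = rest_rel A e \<union> gr (t2 G) e"
  "bdry_rel (insert e A) = rest_rel A e \<union> gr (t0 G) e"
proof -
  have F: "F = (F - e) \<union> e"
    by (auto simp: e_eq)
  have "gr (along G A) F = gr (along G A) (F - e) \<union> gr (t2 G) e"
    "gr (along G (insert e A)) F = gr (along G A) (F - e) \<union> gr (t0 G) e"
    by (subst F, auto simp: gr_def image_Un along_edge along_insert)+
  then show "bdry_rel A = rest_rel A e \<union> gr (t2 G) e"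
    "bdry_rel (insert e A) = rest_rel A e \<union> gr (t0 G) e"
    unfolding bdry_rel_along[OF A] bdry_rel_along[OF insert_edges] rest_rel_def
    by (simp_all add: Un_assoc)
qed

lemma gr_edge:
  "gr (t2 G) e = {(x, x2), (x2, x), (x0, x3), (x3, x0)}"
  "gr (t0 G) e = {(x, x0), (x0, x), (x2, x3), (x3, x2)}"
  by (auto simp: gr_def e_eq t0_t2)

lemma eqv_bdry:
  "eqv (bdry_rel A) = eqv (insert (x0, x3) (insert (x, x2) P))"
  "eqv (bdry_rel (insert e A)) = eqv (insert (x2, x3) (insert (x, x0) P))"
  unfolding bdry_rel_split gr_edge by (rule eqv_two_pairs)+

text \<open>One of the two sides of \<open>e\<close> suffices, since \<open>t2\<close> already joins
  \<open>x\<close> to \<open>x2\<close> and \<open>x0\<close> to \<open>x3\<close>.\<close>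

lemma eqv_comp:
  "eqv (comp_rel (insert e A)) = eqv (insert (x, x0) (comp_rel A))"
proof -
  have *: "comp_rel (insert e A) = comp_rel A \<union> gr (t0 G) e"
    by (auto simp: comp_rel_def gr_def)
  have "(x2, x) \<in> eqv (insert (x, x0) (comp_rel A))"
    "(x, x0) \<in> eqv (insert (x, x0) (comp_rel A))"
    "(x0, x3) \<in> eqv (insert (x, x0) (comp_rel A))"
    by (auto intro!: eqv_incl simp: comp_rel_def gr_iff)
  then have "(x2, x3) \<in> eqv (insert (x, x0) (comp_rel A))"
    by (meson eqv_trans)
  then show ?thesis
    unfolding * gr_edge eqv_two_pairs by (rule eqv_insert_redundant)
qed

lemma comp_step:
  "num_classes F (comp_rel A) = num_classes F (comp_rel (insert e A)) +
     (if (x, x0) \<in> eqv (comp_rel A) then 0 else 1)"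
  using num_classes_insert[of F x x0 "comp_rel A"] num_classes_eqvI[OF eqv_comp, of F] by simp

text \<open>Both boundary counts are compared with that of \<open>P\<close>, from which either
  boundary relation arises by adding two pairs.\<close>

lemma bdry_steps:
  "num_classes F P = num_classes F (bdry_rel A) + (if (x, x2) \<in> eqv P then 0 else 1) +
     (if (x0, x3) \<in> eqv (insert (x, x2) P) then 0 else 1)"
  "num_classes F P = num_classes F (bdry_rel (insert e A)) + (if (x, x0) \<in> eqv P then 0 else 1) +
     (if (x2, x3) \<in> eqv (insert (x, x0) P) then 0 else 1)"
  using num_classes_insert[of F x x2 P] num_classes_insert[of F x0 x3 "insert (x, x2) P"]
    num_classes_insert[of F x x0 P] num_classes_insert[of F x2 x3 "insert (x, x0) P"]
    num_classes_eqvI[OF eqv_bdry(1), of F] num_classes_eqvI[OF eqv_bdry(2), of F] by simp_all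

text \<open>Each of the four flags has a partner by \<open>rest_partner\<close>, which leaves one of
  the three perfect matchings. They are not asserted to exclude each other: parity alone would allow
  all four flags in one class.\<close>

lemma pairing:
  "(x, x2) \<in> eqv P \<and> (x0, x3) \<in> eqv P \<or> (x, x0) \<in> eqv P \<and> (x2, x3) \<in> eqv P \<or>
   (x, x3) \<in> eqv P \<and> (x0, x2) \<in> eqv P"
proof -
  have "\<exists>b\<in>{x, x0, x2, x3}. b \<noteq> a \<and> (a, b) \<in> eqv P" if "a \<in> {x, x0, x2, x3}" for a
    using rest_partner[OF A e, of a] that unfolding e_eq .
  from this[of x] this[of x0] this[of x2] this[of x3]
  have "(x, x0) \<in> eqv P \<or> (x, x2) \<in> eqv P \<or> (x, x3) \<in> eqv P"
    "(x0, x) \<in> eqv P \<or> (x0, x2) \<in> eqv P \<or> (x0, x3) \<in> eqv P"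
    "(x2, x) \<in> eqv P \<or> (x2, x0) \<in> eqv P \<or> (x2, x3) \<in> eqv P"
    "(x3, x) \<in> eqv P \<or> (x3, x0) \<in> eqv P \<or> (x3, x2) \<in> eqv P"
    by blast+
  then show ?thesis
    by (elim disjE) (meson eqv_sym eqv_trans)+
qed

text \<open>Adding an edge does not lower the Euler genus. Inside a component it creates at most one
  boundary curve; between two components it merges two curves into one.\<close>

lemma euler_step:
  "num_classes F (bdry_rel (insert e A)) + 2 * num_classes F (comp_rel A) \<le>
   num_classes F (bdry_rel A) + 1 + 2 * num_classes F (comp_rel (insert e A))"
proof (cases "(x, x0) \<in> eqv (comp_rel A)")
  case True
  \<comment> \<open>Under each matching one of the two \<open>t2\<close> pairs is redundant, so
    \<open>P\<close> has at most one class more than \<open>bdry_rel A\<close>.\<close>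
  have "(x, x2) \<in> eqv P \<or> (x0, x3) \<in> eqv (insert (x, x2) P)"
    using pairing eqv_sym[of x x0 P] unfolding eqv_insert by blast
  then show ?thesis
    using comp_step bdry_steps True by (auto split: if_splits)
next
  case False
  \<comment> \<open>The arcs of \<open>P\<close> stay within components of \<open>A\<close>. Since
    \<open>x0\<close> and \<open>x3\<close> lie at the far end of \<open>e\<close>, only the
    matching of \<open>x\<close> with \<open>x2\<close> and \<open>x0\<close> with \<open>x3\<close>
    remains.\<close>
  have sub: "eqv P \<subseteq> eqv (comp_rel A)"
    unfolding rest_rel_def comp_rel_def
    by (intro eqv_mono subrelI) (auto simp: gr_iff along_def split: if_splits)
  have "(x3, x0) \<in> eqv (comp_rel A)"
    by (auto intro!: eqv_incl simp: comp_rel_def gr_iff)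
  then have x0: "(x, x0) \<notin> eqv P" and "(x, x3) \<notin> eqv P"
    using sub False eqv_trans[of x x3 "comp_rel A" x0] by blast+
  then have *: "(x, x2) \<in> eqv P" "(x0, x3) \<in> eqv P"
    using pairing by auto
  then have "(x2, x3) \<in> eqv (insert (x, x0) P)"
    unfolding eqv_insert using eqv_sym[of x x2 P] by blast
  then have "num_classes F P = num_classes F (bdry_rel (insert e A)) + 1"
    using bdry_steps(2) x0 by simp
  moreover have "num_classes F P = num_classes F (bdry_rel A)"
    using bdry_steps(1) * by (simp add: eqv_insert)
  ultimately show ?thesis
    using comp_step False by simp
qed

lemma rank_step:
  "num_classes F (comp_rel A) \<le> num_classes F (comp_rel (insert e A)) + 1"
  using comp_step by simp

text \<open>Every step of \<open>P\<close> changes sides of the colouring \<open>S\<close>. An arc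
  between flags of \<open>e\<close> begins and ends with a \<open>t1\<close> step and alternates, so
  it has odd length and joins opposite colours. Counting pairs replaces following the arc.\<close>

lemma orientable_pairing:
  assumes S: "\<forall>y\<in>F. \<forall>f\<in>{t0 G, t1 G, t2 G}. f y \<in> S \<longleftrightarrow> y \<notin> S"
    and xS: "x \<in> S"
  shows "(x, x3) \<notin> eqv P \<and> ((x, x0) \<in> eqv P \<longleftrightarrow> (x, x2) \<notin> eqv P)"
proof -
  define K where "K = eqv P `` {x}"
  \<comment> \<open>A list of pairs that still connects \<open>K\<close>, each unordered pair taken once: too few of them
    remain if \<open>K\<close> contains both flags of \<open>e\<close> in \<open>S\<close>.\<close>
  define R where "R = gr (t1 G) (K \<inter> S) \<union> gr (along G A) (K \<inter> S - e)"
  note closed = rest_class_closed[OF A e xF, folded K_def]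
  have K: "K \<subseteq> F"
    using closed(1) by blast
  then have fin: "finite K"
    using finite_flags finite_subset by blast
  have closed1: "t1 G y \<in> K" if "y \<in> K" for y
    using closed(2)[OF that] .
  have closed2: "along G A y \<in> K - e" if "y \<in> K - e" for y
    using closed(3)[of y] that by blast
  have S1: "t1 G y \<in> S \<longleftrightarrow> y \<notin> S" and S2: "along G A y \<in> S \<longleftrightarrow> y \<notin> S" if "y \<in> K" for y
    using S that K by (auto simp: along_def)
  have card1: "card (K \<inter> S) = card (K - S)"
  proof (rule bij_betw_same_card)
    show "bij_betw (t1 G) (K \<inter> S) (K - S)"
      by (rule bij_betw_byWitness[where f' = "t1 G"]) (use K closed1 S1 in auto)
  qed
  have card2: "card (K \<inter> S - e) = card (K - S - e)"
  proof (rule bij_betw_same_card)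
    show "bij_betw (along G A) (K \<inter> S - e) (K - S - e)"
      by (rule bij_betw_byWitness[where f' = "along G A"])
        (use K closed2 S2 along_flags[OF A] in auto)
  qed
  have card3: "card (K \<inter> S) = card (K \<inter> S - e) + card (K \<inter> S \<inter> e)"
    "card (K - S) = card (K - S - e) + card ((K - S) \<inter> e)"
    using fin by (metis add.commute card_Int_Diff finite_Int finite_Diff)+
  have cardK: "card K = card (K \<inter> S) + card (K - S)"
    using fin by (rule card_Int_Diff)
  have R_step: "(u, v) \<in> eqv R" if "(u, v) \<in> P" "u \<in> K" for u v
  proof (cases "(u, v) \<in> R")
    case False
    \<comment> \<open>A pair starting outside \<open>S\<close> is listed from its other end, which
      lies in \<open>S\<close>.\<close>
    then have "(v, u) \<in> R"
      using that K closed1[of u] closed2[of u] S1[of u] S2[of u] along_flags[OF A, of u]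
      by (auto simp: R_def rest_rel_def gr_iff)
    then show ?thesis
      by (intro eqv_sym[OF eqv_incl])
  qed (rule eqv_incl)
  have "(x, y) \<in> eqv R" if "y \<in> K" for y
  proof -
    have "(x, y) \<in> eqv P"
      using that by (simp add: K_def)
    then have "y \<in> K \<and> (x, y) \<in> eqv R"
    proof (rule eqv_invariant[where Q = "\<lambda>y. y \<in> K \<and> (x, y) \<in> eqv R"])
      fix u v assume uv: "(u, v) \<in> P"
      have "u \<in> K \<longleftrightarrow> v \<in> K"
        unfolding K_def using uv by (rule eqv_class_closed)
      moreover have "(x, u) \<in> eqv R \<longleftrightarrow> (x, v) \<in> eqv R" if "u \<in> K"
        using R_step[OF uv that] eqv_trans[of x u R v] eqv_trans[of x v R u] eqv_sym[of u v R]
        by blast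
      ultimately show "(u \<in> K \<and> (x, u) \<in> eqv R) = (v \<in> K \<and> (x, v) \<in> eqv R)"
        by blast
    qed (simp add: K_def)
    then show ?thesis by simp
  qed
  then have "K // eqv R \<subseteq> {eqv R `` {x}}"
    by (auto simp: quotient_def eqv_class_eq[symmetric])
  then have "num_classes K R \<le> 1"
    using card_mono[of "{eqv R `` {x}}" "K // eqv R"] by (simp add: num_classes_def)
  moreover have "card K \<le> num_classes K R + card R"
    using fin closed1 closed2
    by (intro card_le_num_classes) (auto simp: R_def gr_def)
  moreover have "card R \<le> card (K \<inter> S) + card (K \<inter> S - e)"
  proof -
    have "card R \<le> card (gr (t1 G) (K \<inter> S)) + card (gr (along G A) (K \<inter> S - e))"
      unfolding R_def by (rule card_Un_le)
    also have "\<dots> \<le> card (K \<inter> S) + card (K \<inter> S - e)"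
      unfolding gr_def using fin by (intro add_mono card_image_le) auto
    finally show ?thesis .
  qed
  \<comment> \<open>As \<open>t1\<close> swaps the colours, \<open>card K\<close> is twice
    \<open>card (K \<inter> S)\<close>, while connecting \<open>K\<close> takes at least
    \<open>card K - 1\<close> pairs.\<close>
  ultimately have le: "card (K \<inter> S \<inter> e) \<le> 1"
    using card1 card3 cardK by linarith
  have side: "x0 \<notin> S" "x2 \<notin> S" "x3 \<in> S"
    using S xS by auto
  have xK: "x \<in> K"
    by (simp add: K_def)
  have x3: "x3 \<notin> K"
  proof
    assume "x3 \<in> K"
    then have "{x, x3} \<subseteq> K \<inter> S \<inter> e"
      using side xS xK e_eq by auto
    then have "card {x, x3} \<le> card (K \<inter> S \<inter> e)"
      using fin by (intro card_mono) auto
    moreover have "card {x, x3} = 2"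
      using t2_t0_neq[OF xF] by (metis card_2_iff)
    ultimately show False using le by simp
  qed
  then have "K \<inter> S \<inter> e = {x}"
    using side xS xK e_eq by auto
  \<comment> \<open>Both \<open>t1\<close> and \<open>along G A\<close> match the colours within
    \<open>K\<close>, so the flags of \<open>e\<close> in \<open>K\<close> are balanced too: exactly
    one of \<open>x0\<close> and \<open>x2\<close> accompanies \<open>x\<close>.\<close>
  moreover have "card ((K - S) \<inter> e) = card (K \<inter> S \<inter> e)"
    using card1 card2 card3 by linarith
  moreover have "(K - S) \<inter> e = K \<inter> {x0, x2}"
    using side xS e_eq by auto
  ultimately have "card (K \<inter> {x0, x2}) = 1" by simp
  then have "x0 \<in> K \<longleftrightarrow> x2 \<notin> K"
    using t0_neq_t2[OF xF] by (cases "x0 \<in> K"; cases "x2 \<in> K") auto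
  then show ?thesis
    using x3 by (simp add: K_def)
qed

text \<open>With the matching of \<open>x\<close> to \<open>x3\<close> excluded, the ribbon either
  merges two boundary curves or splits one, so the count changes by exactly one.\<close>

lemma orientable_step:
  assumes S: "\<forall>y\<in>F. \<forall>f\<in>{t0 G, t1 G, t2 G}. f y \<in> S \<longleftrightarrow> y \<notin> S"
    and xS: "x \<in> S"
  shows "odd (num_classes F (bdry_rel A) + num_classes F (bdry_rel (insert e A)))"
proof -
  consider "(x, x2) \<in> eqv P" "(x0, x3) \<in> eqv P" "(x, x0) \<notin> eqv P" "(x, x3) \<notin> eqv P"
    | "(x, x0) \<in> eqv P" "(x2, x3) \<in> eqv P" "(x, x2) \<notin> eqv P" "(x, x3) \<notin> eqv P"
    using pairing orientable_pairing[OF S xS] by blast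
  then show ?thesis
  proof cases
    case 1
    then have "(x2, x3) \<in> eqv (insert (x, x0) P)"
      unfolding eqv_insert using eqv_sym[of x x2 P] by blast
    moreover have "(x0, x3) \<in> eqv (insert (x, x2) P)"
      using 1 by (simp add: eqv_insert)
    ultimately have "num_classes F (bdry_rel A) = Suc (num_classes F (bdry_rel (insert e A)))"
      using bdry_steps 1 by simp
    then show ?thesis by simp
  next
    case 2
    then have "(x0, x3) \<in> eqv (insert (x, x2) P)"
      unfolding eqv_insert using eqv_sym[of x x0 P] by blast
    moreover have "(x2, x3) \<in> eqv (insert (x, x0) P)"
      using 2 by (simp add: eqv_insert)
    ultimately have "num_classes F (bdry_rel (insert e A)) = Suc (num_classes F (bdry_rel A))"
      using bdry_steps 2 by simp
    then show ?thesis by simp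
  qed
qed

end

section \<open>Euler genus and duality\<close>

context ribbon
begin

lemma num_bdry_empty: "num_bdry G {} = card (verts G)"
  by (simp add: num_bdry_eq card_verts bdry_rel_def comp_rel_def gr_def)

lemma num_comps_empty: "num_comps G {} = card (verts G)"
  by (simp add: num_comps_eq card_verts)

text \<open>Besides the new edge, the step provides one of its flags, so that it takes place in the
  locale \<open>ribbon_edge\<close>.\<close>

lemma subset_edges_induct [consumes 1, case_names empty insert]:
  assumes "A \<subseteq> edges G" "Q {}"
    and "\<And>A e x. ribbon_edge G A e x \<Longrightarrow> Q A \<Longrightarrow> Q (insert e A)"
  shows "Q A"
proof -
  have "finite A"
    using assms(1) finite_edges finite_subset by blast
  then show ?thesis
    using assms(1)
  proof (induction A rule: finite_induct)
    case (insert e A)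
    then have "e \<in> edge_of ` F"
      using edges_eq by simp
    then obtain x where "x \<in> e"
      using edge_of_self by blast
    then have "ribbon_edge G A e x"
      using insert by unfold_locales auto
    then show ?case
      using insert assms(3) by blast
  qed (use assms(2) in simp)
qed

lemma finite_subset_edges: "A \<subseteq> edges G \<Longrightarrow> finite A"
  using finite_edges finite_subset by blast

lemma rank_le_card:
  assumes "A \<subseteq> edges G"
  shows "card (verts G) \<le> num_comps G A + card A"
  using assms
proof (induction A rule: subset_edges_induct)
  case empty
  then show ?case by (simp add: num_comps_empty)
next
  case (insert A e x)
  then interpret ribbon_edge G A e x by simp
  show ?case
    using insert.IH rank_step new finite_subset_edges[OF A]
    by (simp add: num_comps_eq[OF A] num_comps_eq[OF insert_edges])
qed

text \<open>The difference of the two sides is the Euler genus of the ribbon subgraph. It is zero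
  without edges and never falls, by \<open>euler_step\<close>.\<close>

lemma euler_genus_nonneg:
  assumes "A \<subseteq> edges G"
  shows "card (verts G) + num_bdry G A \<le> 2 * num_comps G A + card A"
  using assms
proof (induction A rule: subset_edges_induct)
  case empty
  then show ?case by (simp add: num_comps_empty num_bdry_empty)
next
  case (insert A e x)
  then interpret ribbon_edge G A e x by simp
  show ?case
    using insert.IH euler_step new finite_subset_edges[OF A]
    by (simp add: num_comps_eq[OF A] num_comps_eq[OF insert_edges]
        num_bdry_eq[OF A] num_bdry_eq[OF insert_edges])
qed

lemma orientable_euler_even:
  assumes "surface_orientable G" "A \<subseteq> edges G"
  shows "even (card (verts G) + card A + num_bdry G A)"
  using assms(2)
proof (induction A rule: subset_edges_induct)
  case empty
  then show ?case by (simp add: num_bdry_empty)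
next
  case (insert A e x)
  then interpret ribbon_edge G A e x by simp
  obtain S where S: "\<forall>y\<in>F. \<forall>f\<in>{t0 G, t1 G, t2 G}. f y \<in> S \<longleftrightarrow> y \<notin> S"
    using assms(1) unfolding surface_orientable_def by blast
  \<comment> \<open>The parity step needs a base flag in \<open>S\<close>; if \<open>x\<close> is
    not one, the other end of its side is.\<close>
  obtain x' where x': "x' \<in> e" "x' \<in> S"
  proof (cases "x \<in> S")
    case True
    then show ?thesis using that x by blast
  next
    case False
    then have "x0 \<in> S" "x0 \<in> e"
      using S by (auto simp: e_eq)
    then show ?thesis using that by blast
  qed
  interpret x': ribbon_edge G A e x'
    using A e new x'(1) by unfold_locales
  show ?case
    using insert.IH x'.orientable_step[OF S x'(2)] new finite_subset_edges[OF A]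
    by (auto simp: num_bdry_eq[OF A] num_bdry_eq[OF insert_edges])
qed

section \<open>Geometric duality\<close>

lemma dual_ribbon: "ribbon (dual G)"
  using is_ribbon_graph_dual[OF ribbon] by unfold_locales

lemma dual_simps:
  "flags (dual G) = F" "t0 (dual G) = t2 G" "t1 (dual G) = t1 G" "t2 (dual G) = t0 G"
  "isolated (dual G) = isolated G"
  by (simp_all add: dual_def)

lemma Union_Diff_edges:
  assumes "A \<subseteq> edges G"
  shows "\<Union>(edges G - A) = F - \<Union>A"
proof (intro set_eqI iffI)
  fix x assume x: "x \<in> \<Union>(edges G - A)"
  then have "x \<in> F"
    using Union_edges by blast
  then show "x \<in> F - \<Union>A"
    using in_Union_iff[OF assms, of x] in_Union_iff[of "edges G - A" x] x by auto
next
  fix x assume x: "x \<in> F - \<Union>A"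
  then have "x \<in> \<Union>(edges G)"
    using Union_edges by blast
  then show "x \<in> \<Union>(edges G - A)"
    using x by blast
qed

text \<open>The two ribbon subgraphs share their boundary curves: exchanging \<open>t0\<close> with
  \<open>t2\<close> and \<open>A\<close> with its complement leaves \<open>bdry_rel\<close>
  unchanged.\<close>

lemma num_bdry_dual:
  assumes "A \<subseteq> edges G"
  shows "num_bdry (dual G) (edges G - A) = num_bdry G A"
proof -
  interpret dual: ribbon "dual G" by (rule dual_ribbon)
  have "F - (F - \<Union>A) = \<Union>A"
    using Union_subset[OF assms] by auto
  then have "dual.bdry_rel (edges G - A) = bdry_rel A"
    unfolding dual.bdry_rel_def bdry_rel_def dual_simps Union_Diff_edges[OF assms] by auto
  then show ?thesis
    using assms by (simp add: num_bdry_eq dual.num_bdry_eq edges_dual dual_simps)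
qed

lemma card_verts_dual: "card (verts (dual G)) = num_bdry G (edges G)"
  using ribbon.num_bdry_empty[OF dual_ribbon] num_bdry_dual[of "edges G"] by simp

lemma comp_rel_subset: "A \<subseteq> edges G \<Longrightarrow> comp_rel A \<subseteq> F \<times> F"
  using gr_subset[of F] gr_subset(1)[OF Union_subset, of A] unfolding comp_rel_def by blast

lemma finite_comp_rel: "A \<subseteq> edges G \<Longrightarrow> finite (comp_rel A)"
  by (rule finite_subset[OF comp_rel_subset]) simp_all

lemma num_comps_ge:
  assumes "A \<subseteq> edges G"
  shows "num_comps G (edges G) \<le> num_comps G A"
proof -
  have "comp_rel A \<subseteq> comp_rel (edges G)"
    using gr_mono[of "\<Union>A" "\<Union>(edges G)" "t0 G"] assms unfolding comp_rel_def by blast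
  then show ?thesis
    using assms by (simp add: num_comps_eq num_classes_antimono comp_rel_subset finite_comp_rel)
qed

lemma comp_rel_edges: "comp_rel (edges G) = gr (t1 G) F \<union> gr (t2 G) F \<union> gr (t0 G) F"
  by (simp add: comp_rel_def Union_edges)

lemma num_comps_dual_edges: "num_comps (dual G) (edges G) = num_comps G (edges G)"
proof -
  interpret dual: ribbon "dual G" by (rule dual_ribbon)
  show ?thesis
    using dual.num_comps_eq[of "edges G"] dual.comp_rel_edges
    by (simp add: num_comps_eq edges_dual dual_simps comp_rel_edges Un_ac)
qed

text \<open>This is the bound on pieces after cutting along the boundary curves. It is submodularity
  for the two component relations: \<open>bdry_rel A\<close> lies below both, and their union is the
  relation of the whole graph.\<close>

lemma num_comps_dual_le:
  assumes "A \<subseteq> edges G"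
  shows "num_comps G A + num_comps (dual G) (edges G - A) \<le> num_bdry G A + num_comps G (edges G)"
proof -
  interpret dual: ribbon "dual G" by (rule dual_ribbon)
  have D: "dual.comp_rel (edges G - A) = gr (t1 G) F \<union> gr (t0 G) F \<union> gr (t2 G) (F - \<Union>A)"
    unfolding dual.comp_rel_def dual_simps Union_Diff_edges[OF assms] ..
  have mono: "gr (t0 G) (\<Union>A) \<subseteq> gr (t0 G) F" "gr (t2 G) (F - \<Union>A) \<subseteq> gr (t2 G) F"
    using Union_subset[OF assms] by (auto intro!: gr_mono)
  have "num_classes F (dual.comp_rel (edges G - A)) + num_classes F (bdry_rel A \<union> comp_rel A)
      \<le> num_classes F (bdry_rel A) + num_classes F (dual.comp_rel (edges G - A) \<union> comp_rel A)"
    using finite_comp_rel[OF assms] comp_rel_subset[OF assms] mono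
    by (intro num_classes_submodular) (auto simp: D bdry_rel_def)
  moreover have "bdry_rel A \<union> comp_rel A = comp_rel A"
    using mono by (auto simp: bdry_rel_def comp_rel_def)
  moreover have "dual.comp_rel (edges G - A) \<union> comp_rel A = comp_rel (edges G)"
    using mono unfolding D comp_rel_edges by (auto simp: comp_rel_def)
  ultimately show ?thesis
    using assms by (simp add: num_comps_eq dual.num_comps_eq num_bdry_eq edges_dual dual_simps)
qed

lemma num_comps_connected:
  assumes "surface_connected G"
  shows "num_comps G (edges G) = 1"
proof -
  have "{(x, f x) | x f. x \<in> F \<and> f \<in> {t0 G, t1 G, t2 G}} = comp_rel (edges G)"
    unfolding comp_rel_edges gr_def by auto
  moreover have "sym (comp_rel (edges G))"
    unfolding comp_rel_edges by (intro sym_Un sym_gr) auto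
  ultimately have "orbits_on F {t0 G, t1 G, t2 G} = F // eqv (comp_rel (edges G))"
    by (simp add: orbits_on_def eqv_of_sym)
  then show ?thesis
    using assms by (simp add: surface_connected_def num_comps_eq num_classes_def)
qed

end

section \<open>Evaluation of polynomials\<close>

definition ring_hom_fun :: "('a::comm_ring_1 \<Rightarrow> 'b::comm_ring_1) \<Rightarrow> bool" where
  "ring_hom_fun h \<longleftrightarrow>
     h 1 = 1 \<and> (\<forall>a b. h (a + b) = h a + h b) \<and> (\<forall>a b. h (a * b) = h a * h b)"

lemma ring_hom_fun_simps:
  assumes "ring_hom_fun h"
  shows "h 0 = 0" "h 1 = 1" "h (a + b) = h a + h b" "h (a * b) = h a * h b"
    "h (a - b) = h a - h b" "h (a ^ n) = h a ^ n" "h (sum f A) = (\<Sum>i\<in>A. h (f i))"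
proof -
  have add: "h (a + b) = h a + h b" and mult: "h (a * b) = h a * h b" and one: "h 1 = 1" for a b
    using assms by (auto simp: ring_hom_fun_def)
  have zero: "h 0 = 0"
    using add[of 0 0] by simp
  show "h 0 = 0" "h 1 = 1" "h (a + b) = h a + h b" "h (a * b) = h a * h b"
    by (fact zero one add mult)+
  show "h (a - b) = h a - h b"
    using add[of "a - b" b] by (simp add: algebra_simps)
  show "h (a ^ n) = h a ^ n"
    by (induction n) (simp_all add: one mult)
  show "h (sum f A) = (\<Sum>i\<in>A. h (f i))"
    by (induction A rule: infinite_finite_induct) (simp_all add: zero add)
qed

text \<open>Applied three times, from \<open>of_int\<close> outwards through the variables
  \<open>x\<close>, \<open>y\<close> and \<open>z\<close>.\<close>

lemma ring_hom_fun_poly_map_poly: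
  assumes "ring_hom_fun h"
  shows "ring_hom_fun (\<lambda>p. poly (map_poly h p) x)"
proof -
  note h = ring_hom_fun_simps[OF assms]
  have add: "poly (map_poly h (p + q)) x = poly (map_poly h p) x + poly (map_poly h q) x" for p q
    by (induction p q rule: poly_induct2) (simp_all add: map_poly_pCons h algebra_simps)
  have mult: "poly (map_poly h (p * q)) x = poly (map_poly h p) x * poly (map_poly h q) x" for p q
    by (induction p) (simp_all add: map_poly_pCons map_poly_smult h add algebra_simps)
  show ?thesis
    using add mult by (simp add: ring_hom_fun_def h)
qed

lemma ring_hom_fun_eval2: "ring_hom_fun (\<lambda>q. eval2 q x y)"
  unfolding eval2_def
  by (intro ring_hom_fun_poly_map_poly) (simp add: ring_hom_fun_def)

lemma ring_hom_fun_eval3: "ring_hom_fun (\<lambda>p. eval3 p x y z)"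
  unfolding eval3_def by (intro ring_hom_fun_poly_map_poly ring_hom_fun_eval2)

lemmas eval2_hom = ring_hom_fun_simps[OF ring_hom_fun_eval2]
lemmas eval3_hom = ring_hom_fun_simps[OF ring_hom_fun_eval3]

lemma eval2_vars: "eval2 [:[:0, 1:]:] x y = x" "eval2 [:0, 1:] x y = y"
  by (simp_all add: eval2_def map_poly_pCons)

lemma eval3_vars: "eval3 varX x y z = x" "eval3 varY x y z = y" "eval3 varZ x y z = z"
  by (simp_all add: eval3_def varX_def varY_def varZ_def map_poly_pCons eval2_vars eval2_hom)

text \<open>The first two factors are constant in \<open>z\<close>, so the product is a single
  monomial in \<open>z\<close>.\<close>

lemma coeff_perspective_term:
  "coeff ((varX - 1) ^ i * (varY - 1) ^ j * varZ ^ k) n =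
     (if k = n then ([:[:0, 1:]:] - 1) ^ i * ([:0, 1:] - 1) ^ j else 0)"
proof -
  have X: "varX - 1 = monom ([:[:0, 1:]:] - 1) 0" and Y: "varY - 1 = monom ([:0, 1:] - 1) 0"
    by (simp_all add: varX_def varY_def monom_0 one_pCons)
  have Z: "varZ = monom 1 1"
    by (simp add: varZ_def monom_altdef)
  show ?thesis
    unfolding X Y Z monom_power mult_monom by simp
qed

text \<open>Here \<open>g\<close> is half the Euler genus of the subgraph. Adding the two genus
  relations gives \<open>f + g \<le> c + c'\<close>, so \<open>g \<le> 1\<close>; and the exponent
  of \<open>z\<close> equals \<open>c + c' - f + 1 - 2 * g\<close>.\<close>

lemma torus_exponents:
  fixes v v' m a c c' f g :: int
  assumes "v - m + v' = 0" "c + c' \<le> f + 1" "v + f + 2 * g = 2 * c + a" "0 \<le> g"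
    "v' + f \<le> 2 * c' + (m - a)"
  shows "m - v' - a + c' - c + 1 = 1 \<and> f = c + c' \<or>
    (m - v' - a + c' - c + 1 = 0 \<or> m - v' - a + c' - c + 1 = 2) \<and> f + 1 = c + c'"
proof -
  have "g = 0 \<or> g = 1" "f = c + c' \<or> f + 1 = c + c'"
    using assms by linarith+
  then show ?thesis
    using assms by auto
qed

section \<open>Comparison of the two polynomials\<close>

theorem theorem6p10:
  fixes G :: "('f, 'v) ribbon_graph" and t :: "'a::field"
  assumes "is_ribbon_graph G" and "t \<noteq> 0"
  shows "(in_sphere G \<or> in_projective_plane G \<longrightarrow>
            eval3 (las_vergnas_poly G) (t + 1) (t + 1) 1 =
            eval3 (bollobas_riordan_poly G) (t + 1) t (1 / t)) \<and>
         (in_torus G \<longrightarrow>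
            eval2 (coeff (las_vergnas_poly G) 2) (t + 1) (t + 1) +
            t * eval2 (coeff (las_vergnas_poly G) 1) (t + 1) (t + 1) +
            eval2 (coeff (las_vergnas_poly G) 0) (t + 1) (t + 1) =
            eval3 (bollobas_riordan_poly G) (t + 1) t (1 / t))"
proof (cases "surface_connected G")
  case False
  then show ?thesis
    by (simp add: in_sphere_def in_projective_plane_def in_torus_def)
next
  case conn: True
  interpret ribbon G
    using assms(1) by unfold_locales
  interpret dual: ribbon "dual G"
    by (rule dual_ribbon)
  define E where "E = edges G"
  define v where "v = card (verts G)"
  define v' where "v' = card (verts (dual G))"
  define c where "c A = num_comps G A" for A
  define c' where "c' A = num_comps (dual G) (E - A)" for A
  define f where "f A = num_bdry G A" for A
  \<comment> \<open>The exponent of \<open>z\<close> in the Las Vergnas term, with both ranks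
    written through component counts of a connected graph and its dual.\<close>
  define k where "k A = nat (int (card E) - int v' - int (card A) + int (c' A) - int (c A) + 1)" for A
  have cE: "c E = 1" "num_comps (dual G) E = 1"
    using num_comps_connected[OF conn] num_comps_dual_edges by (simp_all add: c_def E_def)
  have euler: "surface_euler_char G = int v - int (card E) + int v'"
    by (simp add: surface_euler_char_def v_def v'_def E_def card_verts_dual)
  have facts: "1 \<le> c A" "1 \<le> c' A" "c A + c' A \<le> f A + 1" "v \<le> c A + card A"
    "v + f A \<le> 2 * c A + card A" "v' + f A \<le> 2 * c' A + (card E - card A)" "card A \<le> card E"
    if A: "A \<subseteq> E" for A
  proof -
    have A': "A \<subseteq> edges G"
      using A by (simp add: E_def)
    have D: "E - A \<subseteq> edges (dual G)"
      by (auto simp: E_def edges_dual)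
    have cardD: "card (E - A) = card E - card A"
      using finite_subset_edges[OF A'] A by (simp add: card_Diff_subset)
    show "1 \<le> c A"
      using num_comps_ge[OF A'] cE(1) by (simp add: c_def E_def)
    show "1 \<le> c' A"
      using dual.num_comps_ge[OF D] cE(2) by (simp add: c'_def E_def edges_dual)
    show "c A + c' A \<le> f A + 1"
      using num_comps_dual_le[OF A'] cE(1) by (simp add: c_def c'_def f_def E_def)
    show "v \<le> c A + card A"
      using rank_le_card[OF A'] by (simp add: v_def c_def)
    show "v + f A \<le> 2 * c A + card A"
      using euler_genus_nonneg[OF A'] by (simp add: v_def c_def f_def)
    show "v' + f A \<le> 2 * c' A + (card E - card A)"
      using dual.euler_genus_nonneg[OF D] num_bdry_dual[OF A'] cardD
      by (simp add: v'_def c'_def f_def E_def)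
    show "card A \<le> card E"
      using A by (intro card_mono) (simp_all add: E_def)
  qed
  have R: "eval3 (bollobas_riordan_poly G) (t + 1) t (1 / t) = (\<Sum>A\<in>Pow E. t ^ (f A - 1))"
  proof -
    have "eval3 (bollobas_riordan_poly G) (t + 1) t (1 / t) = (\<Sum>A\<in>Pow E.
        t ^ nat (graph_rank G (edges G) - graph_rank G A) * t ^ nat (nullity G A) *
        (1 / t) ^ nat (int (num_comps G A) - int (num_bdry G A) + nullity G A))"
      by (simp add: bollobas_riordan_poly_def eval3_hom eval3_vars E_def)
    also have "\<dots> = (\<Sum>A\<in>Pow E. t ^ (f A - 1))"
    proof (rule sum.cong[OF refl])
      fix A assume "A \<in> Pow E"
      then have A: "A \<subseteq> E" by simp
      \<comment> \<open>The Euler genus of the ribbon subgraph; the bounds in \<open>facts\<close>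
        keep this and the other natural subtractions from truncating.\<close>
      define d where "d = 2 * c A + card A - (v + f A)"
      have exps: "nat (graph_rank G (edges G) - graph_rank G A) = c A - 1"
        "nat (nullity G A) = c A + card A - v"
        "nat (int (num_comps G A) - int (num_bdry G A) + nullity G A) = d"
        using facts[OF A] cE(1)
        by (simp_all add: graph_rank_def nullity_def c_def v_def f_def E_def d_def)
      have "(c A - 1) + (c A + card A - v) = (f A - 1) + d"
        using facts[OF A] by (simp add: d_def)
      then have "t ^ (c A - 1) * t ^ (c A + card A - v) = t ^ (f A - 1) * t ^ d"
        by (simp flip: power_add)
      then show "t ^ nat (graph_rank G (edges G) - graph_rank G A) * t ^ nat (nullity G A) *
          (1 / t) ^ nat (int (num_comps G A) - int (num_bdry G A) + nullity G A) = t ^ (f A - 1)"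
        unfolding exps using assms(2) by (simp add: power_one_over)
    qed
    finally show ?thesis .
  qed
  have L: "las_vergnas_poly G = (\<Sum>A\<in>Pow E.
      (varX - 1) ^ (c A - 1) * (varY - 1) ^ (c' A - 1) * varZ ^ k A)"
    unfolding las_vergnas_poly_def perspective_tutte_poly_def E_def[symmetric]
  proof (rule sum.cong[OF refl])
    fix A assume "A \<in> Pow E"
    then have A: "A \<subseteq> E" by simp
    let ?r = "dual_rank E (graph_rank (dual G))"
    \<comment> \<open>The number of dual vertices cancels, and the summand 1 is the single component
      of the whole dual.\<close>
    have rA: "?r A = int (card A) - int (c' A) + 1"
      using cE(2) by (simp add: dual_rank_def graph_rank_def c'_def)
    have rE: "?r E = int (card E) - int v' + 1"
      using cE(2) dual.num_comps_empty by (simp add: dual_rank_def graph_rank_def v'_def)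
    have "nat (graph_rank G E - graph_rank G A) = c A - 1"
      "nat (int (card A) - ?r A) = c' A - 1"
      "nat (?r E - ?r A - (graph_rank G E - graph_rank G A)) = k A"
      using cE(1) by (simp_all add: rA rE graph_rank_def c_def k_def algebra_simps)
    then show "(varX - 1) ^ nat (graph_rank G E - graph_rank G A) *
        (varY - 1) ^ nat (int (card A) - ?r A) *
        varZ ^ nat (?r E - ?r A - (graph_rank G E - graph_rank G A)) =
        (varX - 1) ^ (c A - 1) * (varY - 1) ^ (c' A - 1) * varZ ^ k A"
      by simp
  qed
  have coeff_L: "eval2 (coeff (las_vergnas_poly G) n) (t + 1) (t + 1) =
      (\<Sum>A\<in>Pow E. if k A = n then t ^ (c A + c' A - 2) else 0)" for n
  proof -
    have "eval2 (coeff (las_vergnas_poly G) n) (t + 1) (t + 1) =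
      (\<Sum>A\<in>Pow E. if k A = n then t ^ (c A - 1) * t ^ (c' A - 1) else 0)"
      unfolding L coeff_sum coeff_perspective_term eval2_hom
      by (intro sum.cong) (simp_all add: eval2_hom eval2_vars)
    also have "\<dots> = (\<Sum>A\<in>Pow E. if k A = n then t ^ (c A + c' A - 2) else 0)"
    proof (rule sum.cong[OF refl])
      fix A assume "A \<in> Pow E"
      then have "(c A - 1) + (c' A - 1) = c A + c' A - 2"
        using facts(1,2)[of A] by simp
      then show "(if k A = n then t ^ (c A - 1) * t ^ (c' A - 1) else 0) =
          (if k A = n then t ^ (c A + c' A - 2) else 0)"
        by (simp flip: power_add)
    qed
    finally show ?thesis .
  qed
  show ?thesis
  proof (intro conjI impI)
    assume "in_sphere G \<or> in_projective_plane G"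
    then have \<chi>: "int v - int (card E) + int v' \<ge> 1"
      using euler by (auto simp: in_sphere_def in_projective_plane_def)
    have "eval3 (las_vergnas_poly G) (t + 1) (t + 1) 1 =
        (\<Sum>A\<in>Pow E. t ^ (c A - 1) * t ^ (c' A - 1))"
      by (simp add: L eval3_hom eval3_vars)
    also have "\<dots> = (\<Sum>A\<in>Pow E. t ^ (f A - 1))"
    proof (rule sum.cong[OF refl])
      fix A assume "A \<in> Pow E"
      \<comment> \<open>The two genus bounds add up to
        \<open>2 * f A + \<chi> \<le> 2 * (c A + c' A)\<close>, with \<chi> the Euler
        characteristic. As it is positive, \<open>f A < c A + c' A\<close>, and the cutting bound
        leaves equality.\<close>
      then have "(c A - 1) + (c' A - 1) = f A - 1"
        using facts[of A] \<chi> by simp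
      then show "t ^ (c A - 1) * t ^ (c' A - 1) = t ^ (f A - 1)"
        by (simp flip: power_add)
    qed
    finally show "eval3 (las_vergnas_poly G) (t + 1) (t + 1) 1 =
        eval3 (bollobas_riordan_poly G) (t + 1) t (1 / t)"
      by (simp add: R)
  next
    assume torus: "in_torus G"
    then have \<chi>: "int v - int (card E) + int v' = 0"
      using euler by (simp add: in_torus_def)
    \<comment> \<open>Each edge set contributes to exactly one of the three coefficients, so the
      identity can be checked term by term.\<close>
    have "(if k A = 2 then t ^ (c A + c' A - 2) else 0) +
        t * (if k A = 1 then t ^ (c A + c' A - 2) else 0) +
        (if k A = 0 then t ^ (c A + c' A - 2) else 0) = t ^ (f A - 1)" if A: "A \<subseteq> E" for A
    proof -
      have "even (v + card A + f A)"
        using orientable_euler_even[of A] torus A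
        by (simp add: in_torus_def v_def f_def E_def)
      then have "even (2 * c A + card A - (v + f A))"
        using facts(5)[OF A] by auto
      then obtain g where g: "2 * c A + card A - (v + f A) = 2 * g"
        by (elim evenE)
      have "k A = 1 \<and> f A = c A + c' A \<or> (k A = 0 \<or> k A = 2) \<and> f A + 1 = c A + c' A"
      proof -
        have "int (c A) + int (c' A) \<le> int (f A) + 1"
          "int v + int (f A) + 2 * int g = 2 * int (c A) + int (card A)" "0 \<le> int g"
          "int v' + int (f A) \<le> 2 * int (c' A) + (int (card E) - int (card A))"
          using facts[OF A] g by linarith+
        note torus_exponents[OF \<chi> this]
        moreover have "int (f A) = int (c A) + int (c' A) \<Longrightarrow> f A = c A + c' A"
          "int (f A) + 1 = int (c A) + int (c' A) \<Longrightarrow> f A + 1 = c A + c' A"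
          by linarith+
        ultimately show ?thesis
          unfolding k_def by (elim disjE conjE) simp_all
      qed
      \<comment> \<open>The factor \<open>t\<close> at \<open>k A = 1\<close> makes up for the one
        extra boundary curve.\<close>
      moreover have "t * t ^ (c A + c' A - 2) = t ^ (c A + c' A - 1)"
      proof -
        have "c A + c' A - 1 = Suc (c A + c' A - 2)"
          using facts(1,2)[OF A] by linarith
        then show ?thesis by simp
      qed
      moreover have "c A + c' A - 2 = f A - 1" if "f A + 1 = c A + c' A"
        using that by simp
      ultimately show ?thesis
        by auto
    qed
    then show "eval2 (coeff (las_vergnas_poly G) 2) (t + 1) (t + 1) +
        t * eval2 (coeff (las_vergnas_poly G) 1) (t + 1) (t + 1) +
        eval2 (coeff (las_vergnas_poly G) 0) (t + 1) (t + 1) =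
        eval3 (bollobas_riordan_poly G) (t + 1) t (1 / t)"
      unfolding coeff_L R sum_distrib_left sum.distrib[symmetric] by (intro sum.cong) auto
  qed
qed

end
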